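(* Let $X,Y$ be sets with $|X|<\aleph_0$ and $|Y|\leq\aleph_0$, let $\xi=\min(|X|,|Y|)$, and let $a$ be a partial function from $Y$ to $X$ with $1\leq\alpha=\operatorname{rank}(a)<\xi$. Then $$\operatorname{rank}(\mathcal{PT}_{XY}^a)=\sum_{\mu=\alpha+1}^{\xi}\mu!\binom{|Y|}{\mu}S(|X|+1,\mu+1)+\begin{cases}0&\text{if }a\text{ is non-injective and non-full}\\ S(|X|,\alpha)&\text{if }a\text{ is injective (and non-full)}\\ \binom{|X|}{\alpha}&\text{if }a\text{ is full (and non-injective).}\end{cases}$$
   Context: Maps are written on the right and composed left to right. $\mathcal{PT}_{XY}$ is the set of all partial functions $X\to Y$; $\mathcal{PT}_{XY}^a$ is the sandwich semigroup $(\mathcal{PT}_{XY},\star_a)$ with $f\star_ag=fag$. For a partial function, $\operatorname{rank}(a)=|\operatorname{im}(a)|$, and $a$ is full if $\operatorname{dom}(a)=Y$; for a semigroup $T$, $\operatorname{rank}(T)$ is the least cardinality of a generating set (as a semigroup). $\binom{\kappa}{\mu}$ is the number of subsets of size $\mu$ of a set of size $\kappa$ (so it is $\aleph_0$ when $\kappa=\aleph_0$ and $1\leq\mu<\aleph_0$), and $S(\kappa,\mu)$ is the number of equivalence relations with exactly $\mu$ classes on a set of size $\kappa$. (Since $\alpha<\xi$, $a$ cannot be both injective and full.) *)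

theory Defs
  imports
    "HOL-Library.Extended_Nat"
    "HOL-Library.Countable_Set"
    "HOL-Analysis.Finite_Cartesian_Product"
begin

text \<open>Cardinality of a countable set, with \<open>\<infinity>\<close> standing for \<open>\<aleph>\<^sub>0\<close>. Uncountable sets would
  be sent to \<open>\<infinity>\<close> as well, so this is meaningful for countable sets only; everything measured
  below is countable, see \<open>countable_partial_maps\<close>.\<close>

definition ecard :: "'a set \<Rightarrow> enat" where
  "ecard A = (if finite A then enat (card A) else \<infinity>)"

definition partial_maps :: "'a set \<Rightarrow> 'b set \<Rightarrow> ('a \<rightharpoonup> 'b) set" where
  "partial_maps X Y = {f. dom f \<subseteq> X \<and> ran f \<subseteq> Y}"

text \<open>Maps are written on the right in the informal notation, so \<open>f a g\<close> means first \<open>f\<close>,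
  then \<open>a\<close>, then \<open>g\<close>; the library's \<open>\<circ>\<^sub>m\<close> composes in the opposite order.\<close>

definition sandwich :: "('b \<rightharpoonup> 'a) \<Rightarrow> ('a \<rightharpoonup> 'b) \<Rightarrow> ('a \<rightharpoonup> 'b) \<Rightarrow> ('a \<rightharpoonup> 'b)" where
  "sandwich a f g = g \<circ>\<^sub>m (a \<circ>\<^sub>m f)"

inductive_set subsemigroup_gen :: "('s \<Rightarrow> 's \<Rightarrow> 's) \<Rightarrow> 's set \<Rightarrow> 's set"
  for m :: "'s \<Rightarrow> 's \<Rightarrow> 's" and A :: "'s set" where
  base: "x \<in> A \<Longrightarrow> x \<in> subsemigroup_gen m A"
| mult: "x \<in> subsemigroup_gen m A \<Longrightarrow> y \<in> subsemigroup_gen m A \<Longrightarrow> m x y \<in> subsemigroup_gen m A"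

text \<open>The infimum ranges over a nonempty set (take \<open>A = S\<close>) and is attained.\<close>

definition semigroup_rank :: "'s set \<Rightarrow> ('s \<Rightarrow> 's \<Rightarrow> 's) \<Rightarrow> enat" where
  "semigroup_rank S m = Inf {ecard A | A. A \<subseteq> S \<and> subsemigroup_gen m A = S}"

text \<open>The binomial coefficient of \<open>|A|\<close> over \<open>k\<close>, allowing \<open>A\<close> to be countably infinite.\<close>

definition num_subsets :: "'a set \<Rightarrow> nat \<Rightarrow> enat" where
  "num_subsets A k = ecard {B. B \<subseteq> A \<and> finite B \<and> card B = k}"

definition num_equivs :: "nat \<Rightarrow> nat \<Rightarrow> nat" where
  "num_equivs n k = card {R. equiv {..<n} R \<and> card ({..<n} // R) = k}"

lemma num_subsets_finite: "finite A \<Longrightarrow> num_subsets A k = enat (card A choose k)"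
proof -
  assume fin: "finite A"
  then have "{B. B \<subseteq> A \<and> finite B \<and> card B = k} = {B. B \<subseteq> A \<and> card B = k}"
    using finite_subset by blast
  then show ?thesis
    using fin by (simp add: num_subsets_def ecard_def n_subsets)
qed

lemma sandwich_assoc: "sandwich a (sandwich a f g) h = sandwich a f (sandwich a g h)"
  by (auto simp: sandwich_def map_comp_def fun_eq_iff split: option.splits)

lemma sandwich_closed:
  assumes "f \<in> partial_maps X Y" "g \<in> partial_maps X Y"
  shows "sandwich a f g \<in> partial_maps X Y"
proof -
  have "dom (sandwich a f g) \<subseteq> dom f"
    by (auto simp: sandwich_def map_comp_def split: option.splits)
  moreover have "ran (sandwich a f g) \<subseteq> ran g"
    by (auto simp: sandwich_def map_comp_def ran_def split: option.splits)
  ultimately show ?thesis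
    using assms by (auto simp: partial_maps_def)
qed

lemma countable_partial_maps:
  assumes "finite X" "countable Y"
  shows "countable (partial_maps X Y)"
proof (rule countable_image_inj_on)
  have "countable (PiE X (\<lambda>_. insert None (Some ` Y)))"
    using assms by (intro countable_PiE) auto
  moreover have "(\<lambda>f. restrict f X) ` partial_maps X Y \<subseteq> PiE X (\<lambda>_. insert None (Some ` Y))"
  proof (clarsimp simp: partial_maps_def)
    fix f :: "'a \<rightharpoonup> 'b" and x
    assume "ran f \<subseteq> Y" "f x \<notin> Some ` Y"
    then show "f x = None"
      by (cases "f x") (auto simp: ran_def)
  qed
  ultimately show "countable ((\<lambda>f. restrict f X) ` partial_maps X Y)"
    by (rule countable_subset[rotated])
  show "inj_on (\<lambda>f. restrict f X) (partial_maps X Y)"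
  proof (rule inj_onI)
    fix f g
    assume f: "f \<in> partial_maps X Y" and g: "g \<in> partial_maps X Y"
      and eq: "restrict f X = restrict g X"
    show "f = g"
    proof
      fix x
      show "f x = g x"
      proof (cases "x \<in> X")
        case True
        then show ?thesis using fun_cong[OF eq, of x] by simp
      next
        case False
        then have "x \<notin> dom f" "x \<notin> dom g"
          using f g by (auto simp: partial_maps_def)
        then show ?thesis by (simp add: domIff)
      qed
    qed
  qed
qed

end

theory Submission
  imports Defs "HOL-Combinatorics.Permutations"
begin

text \<open>
  A product \<open>f a g\<close> has rank at most \<open>\<alpha>\<close>, so every map of rank greater than \<open>\<alpha>\<close> is
  irreducible and lies in each generating set; counting these maps by image and kernel gives
  the sum. Conversely, a map of rank \<open>r \<le> \<alpha>\<close> is a product of two maps of rank \<open>r + 1\<close>, because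
  both factors can be given an extra value that is lost in the product: the right factor at a
  point outside \<open>im(a)\<close>, the left factor at a point where \<open>f\<close> is undefined or not injective.
  The left factor can fail to exist only when \<open>r = \<alpha>\<close>. It does so precisely if \<open>a\<close> is injective
  and \<open>f\<close> is full, or \<open>a\<close> is full and \<open>f\<close> is injective. If such a critical \<open>f\<close> is a product,
  then the first factor is again critical and has the same kernel as \<open>f\<close>, so that one
  generator per kernel of critical maps is necessary and sufficient.
\<close>

subsection \<open>Counting maps of a given rank\<close>

lemma ecard_image: "inj_on f A \<Longrightarrow> ecard (f ` A) = ecard A"
  by (simp add: ecard_def card_image finite_image_iff)

lemma ecard_mono: "A \<subseteq> B \<Longrightarrow> ecard A \<le> ecard B"
  by (auto simp: ecard_def card_mono finite_subset)

lemma ecard_image_le: "ecard (f ` A) \<le> ecard A"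
  by (auto simp: ecard_def card_image_le)

lemma ecard_Un_disjoint: "A \<inter> B = {} \<Longrightarrow> ecard (A \<union> B) = ecard A + ecard B"
  by (auto simp: ecard_def card_Un_disjoint)

lemma ecard_Times: "ecard (A \<times> B) = ecard A * ecard B"
  by (auto simp: ecard_def card_cartesian_product finite_cartesian_product_iff zero_enat_def)

lemma ecard_UN_disjoint:
  assumes "finite I" "\<And>i j. i \<in> I \<Longrightarrow> j \<in> I \<Longrightarrow> i \<noteq> j \<Longrightarrow> F i \<inter> F j = {}"
  shows "ecard (\<Union>i\<in>I. F i) = (\<Sum>i\<in>I. ecard (F i))"
  using assms
proof (induction I rule: finite_induct)
  case empty
  then show ?case by (simp add: ecard_def zero_enat_def)
next
  case (insert i I)
  have "F i \<inter> (\<Union>j\<in>I. F j) = {}"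
    using insert by blast
  then show ?case
    using insert by (simp add: ecard_Un_disjoint)
qed

text \<open>Positivity of \<open>k\<close> makes all fibres nonempty, so \<open>g\<close> maps onto
  \<open>T\<close>; hence \<open>S\<close> is infinite as soon as \<open>T\<close> is, and both
  sides are then infinite.\<close>

lemma ecard_fibres:
  assumes "g ` S \<subseteq> T" and "0 < k"
    and "\<And>t. t \<in> T \<Longrightarrow> finite {s \<in> S. g s = t} \<and> card {s \<in> S. g s = t} = k"
  shows "ecard S = enat k * ecard T"
proof -
  have S: "S = (\<Union>t\<in>T. {s \<in> S. g s = t})"
    using assms(1) by auto
  have T: "T \<subseteq> g ` S"
  proof
    fix t assume "t \<in> T"
    then have "{s \<in> S. g s = t} \<noteq> {}"
      using assms(2,3) by (metis card.empty less_numeral_extra(3))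
    then show "t \<in> g ` S" by blast
  qed
  show ?thesis
  proof (cases "finite T")
    case True
    have "card S = (\<Sum>t\<in>T. card {s \<in> S. g s = t})"
      by (subst S, rule card_UN_disjoint) (use True assms(3) in auto)
    moreover have "finite S"
      by (subst S) (use True assms(3) in auto)
    ultimately show ?thesis
      using True assms(3) by (simp add: ecard_def)
  next
    case False
    then have "infinite S"
      using T finite_surj by blast
    then show ?thesis
      using False assms(2) by (simp add: ecard_def zero_enat_def)
  qed
qed

section \<open>Kernels and equivalence relations with a given number of classes\<close>

definition ker_on :: "'a set \<Rightarrow> ('a \<Rightarrow> 'b) \<Rightarrow> ('a \<times> 'a) set" where
  "ker_on A F = {(x, y). x \<in> A \<and> y \<in> A \<and> F x = F y}"

lemma equiv_ker_on: "equiv A (ker_on A F)"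
  by (rule equivI) (auto simp: ker_on_def refl_on_def sym_def trans_def)

text \<open>The classes are the fibres of \<open>F\<close> over the values it takes on
  \<open>A\<close>.\<close>

lemma card_quotient_ker_on: "card (A // ker_on A F) = card (F ` A)"
proof (rule bij_betw_same_card[symmetric])
  show "bij_betw (\<lambda>v. {x \<in> A. F x = v}) (F ` A) (A // ker_on A F)"
  proof (rule bij_betwI')
    fix v w assume "v \<in> F ` A" "w \<in> F ` A"
    then show "({x \<in> A. F x = v} = {x \<in> A. F x = w}) = (v = w)" by auto
  next
    fix v assume "v \<in> F ` A"
    then obtain x where "x \<in> A" "v = F x" by auto
    then have "{x \<in> A. F x = v} = ker_on A F `` {x}" by (auto simp: ker_on_def)
    with \<open>x \<in> A\<close> show "{x \<in> A. F x = v} \<in> A // ker_on A F" by (simp add: quotientI)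
  next
    fix C assume "C \<in> A // ker_on A F"
    then obtain x where "x \<in> A" "C = ker_on A F `` {x}" by (auto elim: quotientE)
    then have "C = {y \<in> A. F y = F x}" by (auto simp: ker_on_def)
    with \<open>x \<in> A\<close> show "\<exists>v\<in>F ` A. C = {x \<in> A. F x = v}" by blast
  qed
qed

lemma ker_on_cong: "(\<And>x. x \<in> A \<Longrightarrow> F x = G x) \<Longrightarrow> ker_on A F = ker_on A G"
  by (auto simp: ker_on_def)

text \<open>Labelling the classes injectively turns \<open>R\<close> into a kernel; this is how maps
  with a prescribed kernel are built below.\<close>

lemma equiv_eq_ker_on:
  assumes "equiv A R" "inj_on b (A // R)"
  shows "R = ker_on A (\<lambda>x. b (R `` {x}))"
proof -
  have "(x, y) \<in> R \<longleftrightarrow> x \<in> A \<and> y \<in> A \<and> b (R `` {x}) = b (R `` {y})" for x y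
    using inj_on_eq_iff[OF assms(2)] equiv_class_eq_iff[OF assms(1), of x y]
    by (auto simp: quotientI)
  then show ?thesis by (auto simp: ker_on_def)
qed

text \<open>Extends the family counted by \<open>num_equivs\<close> to arbitrary carriers, since the
  kernels live on \<open>X\<close> or on \<open>X\<close> with one point added.\<close>

definition equivs :: "'a set \<Rightarrow> nat \<Rightarrow> ('a \<times> 'a) set set" where
  "equivs A k = {R. equiv A R \<and> card (A // R) = k}"

lemma finite_equivs: "finite A \<Longrightarrow> finite (equivs A k)"
  by (rule finite_subset[of _ "Pow (A \<times> A)"]) (auto simp: equivs_def equiv_def refl_on_def)

text \<open>A relation on \<open>A\<close> is pulled back along the inverse of \<open>e\<close>.
  Applying the bound to \<open>e\<close> and to its inverse gives equality in
  \<open>card_equivs\<close>.\<close>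

lemma card_equivs_le:
  assumes "finite B" "bij_betw e A B"
  shows "card (equivs A k) \<le> card (equivs B k)"
proof (rule card_inj_on_le)
  let ?e = "inv_into A e"
  let ?T = "\<lambda>R. ker_on B (\<lambda>y. R `` {?e y})"
  have img: "?e ` B = A"
    using assms(2) by (meson bij_betw_def bij_betw_inv_into)
  show "inj_on ?T (equivs A k)"
  proof (rule inj_onI)
    fix R S assume R: "R \<in> equivs A k" and S: "S \<in> equivs A k" and eq: "?T R = ?T S"
    \<comment> \<open>\<open>Q\<close> can be read off from its transported copy, because
      \<open>?e\<close> undoes \<open>e\<close> on \<open>A\<close>.\<close>
    have mem: "(x, y) \<in> Q \<longleftrightarrow> x \<in> A \<and> y \<in> A \<and> (e x, e y) \<in> ?T Q" if "equiv A Q" for Q x y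
    proof (cases "x \<in> A \<and> y \<in> A")
      case True
      then have "e x \<in> B" "e y \<in> B" "?e (e x) = x" "?e (e y) = y"
        using assms(2) by (auto simp: bij_betw_def)
      then show ?thesis
        using True equiv_class_eq_iff[OF that, of x y] by (simp add: ker_on_def)
    next
      case False
      then show ?thesis
        using equiv_class_eq_iff[OF that, of x y] by blast
    qed
    show "R = S"
      using mem[of R] mem[of S] R S eq by (auto simp: equivs_def)
  qed
  show "?T ` equivs A k \<subseteq> equivs B k"
  proof -
    have "card (B // ?T R) = k" if "R \<in> equivs A k" for R
    proof -
      have "(\<lambda>y. R `` {?e y}) ` B = (\<lambda>x. R `` {x}) ` (?e ` B)"
        by (simp add: image_image)
      then have "(\<lambda>y. R `` {?e y}) ` B = A // R"
        by (auto simp: img quotient_def)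
      then show ?thesis
        using that by (simp add: card_quotient_ker_on equivs_def)
    qed
    then show ?thesis
      by (auto simp: equivs_def equiv_ker_on)
  qed
  show "finite (equivs B k)"
    by (rule finite_equivs[OF assms(1)])
qed

lemma card_equivs:
  assumes "finite A"
  shows "card (equivs A k) = num_equivs (card A) k"
proof -
  obtain e where e: "bij_betw e A {..<card A}"
    using assms ex_bij_betw_finite_nat atLeast0LessThan by metis
  have "card (equivs A k) = card (equivs {..<card A} k)"
    using card_equivs_le[OF _ e] card_equivs_le[OF assms bij_betw_inv_into[OF e]]
    by (simp add: le_antisym)
  then show ?thesis
    by (simp add: num_equivs_def equivs_def)
qed

text \<open>The points where \<open>f\<close> is undefined join the class of \<open>None\<close>, so that partial maps with
  \<open>\<mu>\<close> values correspond to equivalence relations with \<open>\<mu> + 1\<close> classes on \<open>|X| + 1\<close> points.\<close>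

definition option_ker :: "'a set \<Rightarrow> ('a \<rightharpoonup> 'b) \<Rightarrow> ('a option \<times> 'a option) set" where
  "option_ker X f = ker_on (insert None (Some ` X)) (\<lambda>u. Option.bind u f)"

text \<open>Pairs with \<open>None\<close> detect where a map is undefined; the other pairs compare
  values.\<close>

lemma option_ker_eqD:
  assumes "option_ker X f = option_ker X g"
  shows "x \<in> X \<Longrightarrow> f x = None \<longleftrightarrow> g x = None"
    and "x \<in> X \<Longrightarrow> y \<in> X \<Longrightarrow> f x = f y \<longleftrightarrow> g x = g y"
proof -
  have *: "(u, v) \<in> option_ker X f \<longleftrightarrow> (u, v) \<in> option_ker X g" for u v
    using assms by simp
  show "x \<in> X \<Longrightarrow> f x = None \<longleftrightarrow> g x = None"
    using *[of "Some x" None] by (simp add: option_ker_def ker_on_def)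
  show "x \<in> X \<Longrightarrow> y \<in> X \<Longrightarrow> f x = f y \<longleftrightarrow> g x = g y"
    using *[of "Some x" "Some y"] by (simp add: option_ker_def ker_on_def)
qed

lemma option_ker_cong:
  assumes "\<And>x. x \<in> X \<Longrightarrow> f x = None \<longleftrightarrow> g x = None"
    and "\<And>x y. x \<in> X \<Longrightarrow> y \<in> X \<Longrightarrow> f x = f y \<longleftrightarrow> g x = g y"
  shows "option_ker X f = option_ker X g"
proof -
  have "None = f x \<longleftrightarrow> None = g x" if "x \<in> X" for x
    using assms(1)[OF that] by metis
  then show ?thesis
    using assms by (auto simp: option_ker_def ker_on_def)
qed

text \<open>The extra class is that of the added point \<open>None\<close>; it is present even when
  \<open>f\<close> is total on \<open>X\<close>.\<close>

lemma option_ker_mem_equivs: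
  assumes "finite X" "f \<in> partial_maps X Y"
  shows "option_ker X f \<in> equivs (insert None (Some ` X)) (card (ran f) + 1)"
proof -
  have "(\<lambda>u. Option.bind u f) ` insert None (Some ` X) = insert None (Some ` ran f)"
  proof -
    have "f x \<in> insert None (Some ` ran f)" for x
      by (cases "f x") (auto simp: ran_def)
    moreover have "Some y \<in> f ` X" if "y \<in> ran f" for y
    proof -
      obtain x where x: "f x = Some y" using \<open>y \<in> ran f\<close> by (auto simp: ran_def)
      then have "x \<in> X" using assms(2) by (auto simp: partial_maps_def)
      then show ?thesis using x by (metis imageI)
    qed
    ultimately have "f ` X \<subseteq> insert None (Some ` ran f)" "Some ` ran f \<subseteq> f ` X"
      by (simp_all add: image_subset_iff)
    then have "insert None (f ` X) = insert None (Some ` ran f)"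
      by (metis insert_absorb2 insert_mono subset_antisym)
    then show ?thesis
      by (simp add: image_image)
  qed
  moreover have "finite (ran f)"
    using assms by (auto simp: partial_maps_def intro: finite_ran finite_subset)
  ultimately show ?thesis
    by (simp add: equivs_def option_ker_def equiv_ker_on card_quotient_ker_on card_image)
qed

text \<open>The class of \<open>None\<close> becomes the set where \<open>f\<close> is undefined,
  and the remaining \<open>card B\<close> classes are matched with the elements of
  \<open>B\<close>.\<close>

lemma option_ker_surj:
  assumes "finite X" "finite B" "B \<subseteq> Y" "R \<in> equivs (insert None (Some ` X)) (card B + 1)"
  shows "\<exists>f\<in>partial_maps X Y. ran f = B \<and> option_ker X f = R"
proof -
  let ?A = "insert None (Some ` X)"
  let ?c = "R `` {None}"
  have R: "equiv ?A R" "card (?A // R) = card B + 1"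
    using assms(4) by (auto simp: equivs_def)
  \<comment> \<open>The number of classes is positive, whereas \<open>card\<close> is 0 on infinite
    sets.\<close>
  have fin: "finite (?A // R)"
    using R(2) card.infinite by fastforce
  have c: "?c \<in> ?A // R"
    by (rule quotientI) simp
  have "card (?A // R - {?c}) = card B"
    using fin c R(2) by simp
  then obtain b where b: "bij_betw b (?A // R - {?c}) B"
    using fin assms(2) by (metis finite_Diff finite_same_card_bij)
  define b' where "b' C = (if C = ?c then None else Some (b C))" for C
  have inj: "inj_on b' (?A // R)"
    using b by (auto simp: b'_def inj_on_def bij_betw_def)
  define f where "f x = (if x \<in> X then b' (R `` {Some x}) else None)" for x
  have bind: "Option.bind u f = b' (R `` {u})" if "u \<in> ?A" for u
    using that by (cases u) (auto simp: f_def b'_def[of ?c])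
  have "option_ker X f = ker_on ?A (\<lambda>u. b' (R `` {u}))"
    unfolding option_ker_def using bind by (rule ker_on_cong)
  then have ker: "option_ker X f = R"
    using equiv_eq_ker_on[OF R(1) inj] by simp
  have ran: "ran f = B"
  proof
    show "ran f \<subseteq> B"
    proof
      fix y assume "y \<in> ran f"
      then obtain x where "x \<in> X" "b' (R `` {Some x}) = Some y"
        by (auto simp: ran_def f_def split: if_splits)
      then have "R `` {Some x} \<in> ?A // R - {?c}" "b (R `` {Some x}) = y"
        by (auto simp: b'_def quotientI split: if_splits)
      then show "y \<in> B" using b by (auto simp: bij_betw_def)
    qed
    show "B \<subseteq> ran f"
    proof
      fix y assume "y \<in> B"
      then obtain C where C: "C \<in> ?A // R" "C \<noteq> ?c" "b C = y"
        using b by (auto simp: bij_betw_def image_iff)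
      then obtain u where u: "u \<in> ?A" "C = R `` {u}"
        by (auto elim: quotientE)
      with C obtain x where "x \<in> X" "u = Some x" by auto
      with C u have "f x = Some y" by (simp add: f_def b'_def)
      then show "y \<in> ran f" by (auto simp: ran_def)
    qed
  qed
  have "f \<in> partial_maps X Y"
    using ran assms(3) by (auto simp: partial_maps_def f_def dom_def)
  then show ?thesis using ran ker by blast
qed

text \<open>Two maps with the same kernel and the same finite image \<open>B\<close> differ by a
  unique permutation of \<open>B\<close>. This is the source of the factor
  \<open>fact \<mu>\<close>.\<close>

lemma card_option_ker_fibre:
  assumes "finite X" "finite B" "f\<^sub>0 \<in> partial_maps X Y" "ran f\<^sub>0 = B"
  shows "bij_betw (\<lambda>p. map_option p \<circ> f\<^sub>0) {p. p permutes B}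
    {f \<in> partial_maps X Y. ran f = B \<and> option_ker X f = option_ker X f\<^sub>0}" (is "bij_betw ?h ?P ?F")
proof (rule bij_betw_imageI)
  have dom0: "dom f\<^sub>0 \<subseteq> X" and BY: "B \<subseteq> Y"
    using assms(3,4) by (auto simp: partial_maps_def)
  show "inj_on ?h ?P"
  proof (rule inj_onI)
    fix p q assume p: "p \<in> ?P" and q: "q \<in> ?P" and eq: "?h p = ?h q"
    show "p = q"
    proof
      fix y show "p y = q y"
      proof (cases "y \<in> B")
        case True
        then obtain x where "f\<^sub>0 x = Some y" using assms(4) by (auto simp: ran_def)
        then show ?thesis using fun_cong[OF eq, of x] by simp
      next
        case False
        then show ?thesis using p q by (simp add: permutes_not_in)
      qed
    qed
  qed
  show "?h ` ?P = ?F"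
  proof
    show "?h ` ?P \<subseteq> ?F"
    proof (rule image_subsetI)
      fix p assume "p \<in> ?P"
      then have p: "p permutes B" by simp
      have "ran (?h p) = p ` ran f\<^sub>0"
        by (auto simp: ran_def image_iff)
      then have "ran (?h p) = B"
        using p assms(4) by (simp add: permutes_image)
      moreover have "option_ker X (?h p) = option_ker X f\<^sub>0"
      proof (rule option_ker_cong)
        show "?h p x = ?h p y \<longleftrightarrow> f\<^sub>0 x = f\<^sub>0 y" for x y
          using option.inj_map[OF permutes_inj[OF p]] by (auto simp: inj_eq)
      qed simp
      moreover have "dom (?h p) = dom f\<^sub>0"
        by (auto simp: dom_def)
      ultimately show "?h p \<in> ?F"
        using dom0 BY by (simp add: partial_maps_def)
    qed
    show "?F \<subseteq> ?h ` ?P"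
    proof
      fix f assume "f \<in> ?F"
      then have f: "f \<in> partial_maps X Y" "B = ran f" "option_ker X f = option_ker X f\<^sub>0"
        by auto
      note fker = option_ker_eqD[OF f(3)]
      \<comment> \<open>\<open>s\<close> chooses preimages under \<open>f\<^sub>0\<close>, and
        \<open>p\<close> sends \<open>y\<close> to the value of \<open>f\<close> there; equality of
        the kernels makes the choice immaterial.\<close>
      define s where "s y = (SOME x. f\<^sub>0 x = Some y)" for y
      define p where "p y = (if y \<in> B then the (f (s y)) else y)" for y
      have s: "f\<^sub>0 (s y) = Some y" if "y \<in> B" for y
        using that assms(4) unfolding s_def by (auto simp: ran_def intro: someI_ex)
      have key: "f x = Some (p y)" if "f\<^sub>0 x = Some y" for x y
      proof -
        have y: "y \<in> B" using that assms(4) by (auto simp: ran_def)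
        have X: "x \<in> X" "s y \<in> X" using that s[OF y] dom0 by auto
        have "f x = f (s y)" "f x \<noteq> None"
          using fker X that s[OF y] by auto
        then show ?thesis using y by (auto simp: p_def)
      qed
      have "f = ?h p"
      proof
        fix x show "f x = ?h p x"
        proof (cases "f\<^sub>0 x")
          case None
          then have "f x = None"
            using fker(1)[of x] f(1) by (auto simp: partial_maps_def dom_def)
          with None show ?thesis by simp
        qed (simp add: key)
      qed
      moreover have "p permutes B"
      proof (rule bij_imp_permutes)
        \<comment> \<open>\<open>p\<close> maps the finite set \<open>B\<close> onto itself, hence
          is injective on it.\<close>
        have "B = p ` ran f\<^sub>0"
          unfolding f(2) by (subst \<open>f = ?h p\<close>) (auto simp: ran_def image_iff)
        then have "p ` B = B" using assms(4) by simp
        then show "bij_betw p B B"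
          using assms(2) by (simp add: bij_betw_def eq_card_imp_inj_on)
      qed (simp add: p_def)
      ultimately show "f \<in> ?h ` ?P" by blast
    qed
  qed
qed

text \<open>Image and kernel can be prescribed independently, and each such pair is attained by
  exactly \<open>fact \<mu>\<close> maps.\<close>

lemma ecard_rank_eq:
  assumes "finite X"
  shows "ecard {f \<in> partial_maps X Y. card (ran f) = \<mu>} =
    enat (fact \<mu>) * num_subsets Y \<mu> * enat (num_equivs (card X + 1) (\<mu> + 1))"
proof -
  let ?A = "insert None (Some ` X)"
  let ?\<B> = "{B. B \<subseteq> Y \<and> finite B \<and> card B = \<mu>}"
  let ?S = "{f \<in> partial_maps X Y. card (ran f) = \<mu>}"
  let ?g = "\<lambda>f. (ran f, option_ker X f)"
  have "ecard ?S = enat (fact \<mu>) * ecard (?\<B> \<times> equivs ?A (\<mu> + 1))"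
  proof (rule ecard_fibres[where g = ?g])
    show "?g ` ?S \<subseteq> ?\<B> \<times> equivs ?A (\<mu> + 1)"
      using option_ker_mem_equivs[OF assms, of _ Y] assms
      by (auto simp: partial_maps_def intro: finite_ran finite_subset)
  next
    fix t assume "t \<in> ?\<B> \<times> equivs ?A (\<mu> + 1)"
    then obtain B R where t: "t = (B, R)" "B \<subseteq> Y" "finite B" "card B = \<mu>" "R \<in> equivs ?A (card B + 1)"
      by auto
    then obtain f where f: "f \<in> partial_maps X Y" "ran f = B" "option_ker X f = R"
      using option_ker_surj[OF assms] by metis
    have F: "{s \<in> ?S. ?g s = t} = {f \<in> partial_maps X Y. ran f = B \<and> option_ker X f = R}"
      using t by auto
    note bij = card_option_ker_fibre[OF assms t(3) f(1,2), unfolded f(3)]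
    show "finite {s \<in> ?S. ?g s = t} \<and> card {s \<in> ?S. ?g s = t} = fact \<mu>"
      unfolding F using bij_betw_finite[OF bij] bij_betw_same_card[OF bij] t(3,4)
      by (simp add: card_permutations finite_permutations)
  qed simp
  moreover have "finite ?A" "card ?A = card X + 1"
    using assms by (simp_all add: card_image)
  then have "ecard (equivs ?A (\<mu> + 1)) = enat (num_equivs (card X + 1) (\<mu> + 1))"
    using card_equivs[of ?A "\<mu> + 1"] finite_equivs[of ?A "\<mu> + 1"] by (simp add: ecard_def)
  ultimately show ?thesis
    by (simp only: ecard_Times num_subsets_def mult.assoc)
qed


subsection \<open>Kernels of partial maps\<close>

lemma sandwich_apply: "sandwich a f g x = Option.bind (Option.bind (f x) a) g"
  by (cases "f x"; cases "a (the (f x))") (auto simp: sandwich_def map_comp_def)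

lemma partial_mapsD: "f \<in> partial_maps X Y \<Longrightarrow> f x = Some y \<Longrightarrow> x \<in> X \<and> y \<in> Y"
  by (auto simp: partial_maps_def ran_def dom_def)

lemma image_dom_eq_Some_ran: "f ` dom f = Some ` ran f"
proof (intro equalityI subsetI)
  fix v assume "v \<in> Some ` ran f"
  then obtain x y where "v = Some y" "f x = Some y" by (auto simp: ran_def)
  then show "v \<in> f ` dom f" by (metis domI imageI)
qed (auto intro: ranI)

lemma card_ran_le_card_dom: "finite (dom f) \<Longrightarrow> card (ran f) \<le> card (dom f)"
  using card_image_le[of "dom f" f] by (simp add: image_dom_eq_Some_ran card_image)

lemma card_ran_inj: "inj_on f (dom f) \<Longrightarrow> card (ran f) = card (dom f)"
  using card_image[of f "dom f"] by (simp add: image_dom_eq_Some_ran card_image)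

text \<open>Undefined points are left out, so this is an equivalence relation on
  \<open>dom f\<close> and records that domain along with the kernel.\<close>

definition pker :: "('a \<rightharpoonup> 'b) \<Rightarrow> ('a \<times> 'a) set" where
  "pker f = {(x, y). f x = f y \<and> f x \<noteq> None}"

lemma pker_eqI:
  assumes "dom f = dom g" "\<And>x y. x \<in> dom f \<Longrightarrow> y \<in> dom f \<Longrightarrow> f x = f y \<longleftrightarrow> g x = g y"
  shows "pker f = pker g"
proof -
  have "f x = f y \<and> f x \<noteq> None \<longleftrightarrow> g x = g y \<and> g x \<noteq> None" for x y
    using assms(1) assms(2)[of x y] by (metis domIff)
  then show ?thesis by (simp add: pker_def)
qed

lemma pker_eqD:
  assumes "pker f = pker g"
  shows "dom f = dom g" and "x \<in> dom f \<Longrightarrow> f x = f y \<longleftrightarrow> g x = g y"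
proof -
  have *: "f x = f y \<and> f x \<noteq> None \<longleftrightarrow> g x = g y \<and> g x \<noteq> None" for x y
    using assms by (auto simp: pker_def set_eq_iff)
  show d: "dom f = dom g"
    using *[of x x for x] by (auto simp: dom_def)
  show "x \<in> dom f \<Longrightarrow> f x = f y \<longleftrightarrow> g x = g y"
    using *[of x y] d by auto
qed

text \<open>On maps with domain \<open>X\<close> this is the ordinary kernel, and \<open>Y\<close>
  has enough elements to label any \<open>k\<close> classes.\<close>

lemma ecard_pker_total:
  fixes X :: "'a set" and Y :: "'b set"
  assumes "finite X" and "finite Y \<Longrightarrow> k \<le> card Y"
  shows "ecard (pker ` {f \<in> partial_maps X Y. card (ran f) = k \<and> dom f = X})
    = enat (num_equivs (card X) k)"
proof -
  have "pker ` {f \<in> partial_maps X Y. card (ran f) = k \<and> dom f = X} = equivs X k"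
  proof (intro equalityI subsetI)
    fix R assume "R \<in> pker ` {f \<in> partial_maps X Y. card (ran f) = k \<and> dom f = X}"
    then obtain f where "R = pker f" "f \<in> {f \<in> partial_maps X Y. card (ran f) = k \<and> dom f = X}"
      by (rule imageE)
    then have f: "R = pker f" "card (ran f) = k" "dom f = X"
      by simp_all
    have "R = ker_on X f"
      using f by (auto simp: pker_def ker_on_def)
    moreover have "f ` X = Some ` ran f"
      using f(3) image_dom_eq_Some_ran by metis
    ultimately show "R \<in> equivs X k"
      using f(2) by (simp add: equivs_def equiv_ker_on card_quotient_ker_on card_image)
  next
    fix R assume "R \<in> equivs X k"
    then have R: "equiv X R" "card (X // R) = k" by (auto simp: equivs_def)
    have fin: "finite (X // R)"
      using assms(1) R(1) by (simp add: equiv_type finite_quotient)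
    obtain B where B: "B \<subseteq> Y" "finite B" "card B = k"
      using assms(2) by (metis finite_subset infinite_arbitrarily_large obtain_subset_with_card_n)
    obtain b where b: "bij_betw b (X // R) B"
      using fin R(2) B(2,3) by (metis finite_same_card_bij)
    define f where "f x = (if x \<in> X then Some (b (R `` {x})) else None)" for x
    have "R = ker_on X (\<lambda>x. b (R `` {x}))"
      using R(1) bij_betw_imp_inj_on[OF b] by (rule equiv_eq_ker_on)
    moreover have "pker f = ker_on X (\<lambda>x. b (R `` {x}))"
      by (auto simp: pker_def ker_on_def f_def split: if_splits)
    ultimately have "R = pker f"
      by simp
    moreover have dom: "dom f = X"
      by (auto simp: f_def dom_def)
    moreover have "ran f = b ` (X // R)"
      by (auto simp: f_def ran_def quotient_def)
    then have "ran f = B"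
      using b by (simp add: bij_betw_def)
    ultimately show "R \<in> pker ` {f \<in> partial_maps X Y. card (ran f) = k \<and> dom f = X}"
      using B by (auto simp: partial_maps_def)
  qed
  then show ?thesis
    using assms(1) by (simp add: card_equivs ecard_def finite_equivs)
qed

text \<open>The kernel of an injective partial map is the identity on its domain, so these kernels
  correspond to the possible domains.\<close>

lemma ecard_pker_inj:
  fixes X :: "'a set" and Y :: "'b set"
  assumes "finite X" and "finite Y \<Longrightarrow> k \<le> card Y"
  shows "ecard (pker ` {f \<in> partial_maps X Y. card (ran f) = k \<and> inj_on f (dom f)})
    = num_subsets X k"
proof -
  let ?F = "{f \<in> partial_maps X Y. card (ran f) = k \<and> inj_on f (dom f)}"
  have Id: "pker f = Id_on (dom f)" if "inj_on f (dom f)" for f :: "'a \<rightharpoonup> 'b"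
  proof -
    have "f x = f y \<and> f x \<noteq> None \<longleftrightarrow> x = y \<and> x \<in> dom f" for x y
      using that by (metis domIff inj_on_def)
    then show ?thesis by (simp add: pker_def set_eq_iff Id_on_iff)
  qed
  have "dom ` ?F = {B. B \<subseteq> X \<and> finite B \<and> card B = k}"
  proof (intro equalityI subsetI)
    fix D assume "D \<in> dom ` ?F"
    then obtain f where f: "D = dom f" "f \<in> ?F"
      by (rule imageE)
    then show "D \<in> {B. B \<subseteq> X \<and> finite B \<and> card B = k}"
      using card_ran_inj[of f] assms(1) by (auto simp: partial_maps_def intro: finite_subset)
  next
    fix D assume "D \<in> {B. B \<subseteq> X \<and> finite B \<and> card B = k}"
    then have D: "D \<subseteq> X" "finite D" "card D = k" by auto
    obtain B where B: "B \<subseteq> Y" "finite B" "card B = k"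
      using assms(2) by (metis finite_subset infinite_arbitrarily_large obtain_subset_with_card_n)
    obtain b where b: "bij_betw b D B"
      using D B by (metis finite_same_card_bij)
    define f where "f x = (if x \<in> D then Some (b x) else None)" for x
    have "dom f = D" by (auto simp: f_def dom_def)
    moreover have "ran f = B"
      using b by (auto simp: f_def ran_def bij_betw_def)
    moreover have "inj_on f D"
      using b by (auto simp: f_def inj_on_def bij_betw_def)
    ultimately show "D \<in> dom ` ?F"
      using D B by (auto simp: partial_maps_def intro!: image_eqI[of _ _ f])
  qed
  moreover have "pker ` ?F = Id_on ` dom ` ?F"
    using Id by (auto simp: image_image intro!: image_cong)
  moreover have "inj_on Id_on S" for S :: "'a set set"
    by (rule inj_onI) (metis Domain_Id_on)
  ultimately show ?thesis
    by (simp add: ecard_image num_subsets_def)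
qed

subsection \<open>Generating the sandwich semigroup\<close>

lemma semigroup_rank_eqI:
  assumes "A \<subseteq> S" "subsemigroup_gen m A = S"
    and "\<And>B. B \<subseteq> S \<Longrightarrow> subsemigroup_gen m B = S \<Longrightarrow> ecard A \<le> ecard B"
  shows "semigroup_rank S m = ecard A"
  unfolding semigroup_rank_def
  by (rule antisym) (use assms in \<open>auto intro!: Inf_lower Inf_greatest\<close>)

text \<open>The bound \<alpha> < \<xi> is split into two; the one on \<open>Y\<close> is conditional
  because \<open>card\<close> is 0 on infinite sets.\<close>

locale low_rank_sandwich =
  fixes X :: "'a set" and Y :: "'b set" and a :: "'b \<rightharpoonup> 'a" and \<alpha> :: nat
  assumes finite_X: "finite X"
    and a: "a \<in> partial_maps Y X"
    and rank_a: "card (ran a) = \<alpha>"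
    and \<alpha>_pos: "1 \<le> \<alpha>"
    and \<alpha>_less_X: "\<alpha> < card X"
    and \<alpha>_less_Y: "finite Y \<Longrightarrow> \<alpha> < card Y"
begin

abbreviation "S \<equiv> partial_maps X Y"

definition high_rank :: "('a \<rightharpoonup> 'b) set" where
  "high_rank = {f \<in> S. \<alpha> < card (ran f)}"

text \<open>Rank \<alpha> together with the failure of both ways to enlarge the left factor:
  \<open>f\<close> and \<open>a\<close> both undefined somewhere, or both non-injective. Of the four
  combinations, \<open>f\<close> total and injective, or \<open>a\<close> full and injective, are
  excluded by the bounds on \<alpha>.\<close>

definition critical :: "('a \<rightharpoonup> 'b) set" where
  "critical = {f \<in> S. card (ran f) = \<alpha> \<and> (dom f = X \<or> dom a = Y) \<and> (inj_on f (dom f) \<or> inj_on a (dom a))}"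

lemma finite_dom: "f \<in> S \<Longrightarrow> finite (dom f)"
  using finite_X finite_subset by (auto simp: partial_maps_def)

lemma fin_ran: "f \<in> S \<Longrightarrow> finite (ran f)"
  by (simp add: finite_dom finite_ran)

lemma ran_a: "ran a \<subseteq> X" "finite (ran a)"
  using a finite_X finite_subset by (auto simp: partial_maps_def)

lemma dom_a: "dom a \<subseteq> Y"
  using a by (auto simp: partial_maps_def)

lemma dom_a_nonempty: "dom a \<noteq> {}"
  using rank_a \<alpha>_pos by auto

lemma room_X: "\<exists>x\<in>X. x \<notin> ran a"
  using ran_a rank_a \<alpha>_less_X by (metis nat_less_le subsetI subset_antisym)

lemma room_Y:
  assumes "finite R" "card R \<le> \<alpha>"
  shows "\<exists>y\<in>Y. y \<notin> R"
proof (rule ccontr)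
  assume "\<not> (\<exists>y\<in>Y. y \<notin> R)"
  then have "Y \<subseteq> R" by blast
  then show False
    using assms \<alpha>_less_Y by (metis card_mono finite_subset leD le_trans)
qed

text \<open>Finiteness follows from the positive cardinality.\<close>

lemma finite_dom_a_inj:
  assumes "inj_on a (dom a)"
  shows "card (dom a) = \<alpha>" "finite (dom a)"
  using card_ran_inj[OF assms] rank_a \<alpha>_pos by (auto intro: card_ge_0_finite)

section \<open>Factorising maps of rank at most \<alpha>\<close>

text \<open>By \<open>dom\<close> and \<open>ker\<close>, \<open>f\<close> factors through
  \<open>g\<close> followed by \<open>a\<close>. The right factor also takes a new value
  \<open>y\<^sub>0\<close> at a point \<open>x\<^sub>0\<close> outside \<open>ran a\<close>, which
  the product never reaches.\<close>

lemma right_factor: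
  assumes f: "f \<in> S" "card (ran f) \<le> \<alpha>" and g: "g \<in> S"
    and dom: "\<And>x. x \<in> dom f \<Longrightarrow> Option.bind (g x) a \<noteq> None"
    and ker: "\<And>x x'. Option.bind (g x) a = Option.bind (g x') a \<Longrightarrow> Option.bind (g x) a \<noteq> None \<Longrightarrow> f x = f x'"
  shows "\<exists>h\<in>S. card (ran h) = Suc (card (ran f)) \<and> f = sandwich a g h"
proof -
  obtain x\<^sub>0 where x0: "x\<^sub>0 \<in> X" "x\<^sub>0 \<notin> ran a"
    using room_X by blast
  obtain y\<^sub>0 where y0: "y\<^sub>0 \<in> Y" "y\<^sub>0 \<notin> ran f"
    using room_Y fin_ran f by blast
  let ?ga = "\<lambda>x. Option.bind (g x) a"
  \<comment> \<open>By \<open>ker\<close>, the value of \<open>f\<close> does not depend on the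
    chosen preimage of \<open>z\<close>.\<close>
  define h where "h z = (if z = x\<^sub>0 then Some y\<^sub>0 else if \<exists>x. ?ga x = Some z then f (SOME x. ?ga x = Some z) else None)" for z
  have ga_ran: "z \<in> ran a" if "?ga x = Some z" for x z
    using that by (cases "g x") (auto simp: ran_def)
  have h: "h z = f x" if "?ga x = Some z" for x z
  proof -
    have "?ga (SOME x. ?ga x = Some z) = Some z"
      using that by (rule someI)
    then have "f (SOME x. ?ga x = Some z) = f x"
      using that ker[of "SOME x. ?ga x = Some z" x] by simp
    then show ?thesis
      using that x0 ga_ran by (auto simp: h_def)
  qed
  have eq: "f = sandwich a g h"
  proof
    fix x show "f x = sandwich a g h x"
    proof (cases "?ga x")
      case None
      then have "x \<notin> dom f" using dom[of x] by blast
      then show ?thesis using None by (simp add: sandwich_apply domIff)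
    next
      case (Some z)
      then show ?thesis using h[OF Some] by (simp add: sandwich_apply)
    qed
  qed
  have ran: "ran h = insert y\<^sub>0 (ran f)"
  proof (intro equalityI subsetI)
    fix y assume "y \<in> ran h"
    then show "y \<in> insert y\<^sub>0 (ran f)"
      by (auto simp: ran_def h_def split: if_splits)
  next
    fix y assume y: "y \<in> insert y\<^sub>0 (ran f)"
    show "y \<in> ran h"
    proof (cases "y = y\<^sub>0")
      case True
      then show ?thesis by (auto simp: ran_def h_def)
    next
      case False
      then obtain x where x: "f x = Some y" using y by (auto simp: ran_def)
      then obtain z where "?ga x = Some z" using dom[of x] by auto
      then show ?thesis using h x by (metis ranI)
    qed
  qed
  have "z \<in> X" if "h z = Some y" for z y
    using that x0(1) ga_ran ran_a(1) by (auto simp: h_def split: if_splits)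
  then have "h \<in> S"
    using ran y0(1) f(1) by (auto simp: partial_maps_def dom_def)
  moreover have "card (ran h) = Suc (card (ran f))"
    using ran y0(2) fin_ran[OF f(1)] by simp
  ultimately show ?thesis
    using eq by blast
qed

text \<open>Supplies a \<open>g\<close> as required by \<open>right_factor\<close>. Each value
  \<open>v\<close> of \<open>f\<close> is replaced by a representative \<open>u v\<close> whose
  images under \<open>a\<close> are distinct, and \<open>x\<^sub>1\<close> is redirected to the new
  value \<open>y\<close>. No representative is lost, as the value at \<open>x\<^sub>1\<close> is
  also taken elsewhere; the conditions on \<open>y\<close> keep the product compatible with
  \<open>f\<close>.\<close>

lemma left_factor:
  assumes f: "f \<in> S"
    and u: "\<And>v. v \<in> ran f \<Longrightarrow> u v \<in> dom a" "inj_on (\<lambda>v. a (u v)) (ran f)"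
    and x1: "x\<^sub>1 \<in> X" "\<And>v. f x\<^sub>1 = Some v \<Longrightarrow> \<exists>x. x \<noteq> x\<^sub>1 \<and> f x = Some v"
    and y: "y \<in> Y" "y \<notin> u ` ran f" "a y = None \<Longrightarrow> f x\<^sub>1 = None"
      "\<And>v. v \<in> ran f \<Longrightarrow> a y = a (u v) \<Longrightarrow> f x\<^sub>1 = Some v"
  shows "\<exists>g\<in>S. card (ran g) = Suc (card (ran f)) \<and>
    (\<forall>x\<in>dom f. Option.bind (g x) a \<noteq> None) \<and>
    (\<forall>x x'. Option.bind (g x) a = Option.bind (g x') a \<longrightarrow> Option.bind (g x) a \<noteq> None \<longrightarrow> f x = f x')"
proof -
  define g where "g = (map_option u \<circ> f)(x\<^sub>1 \<mapsto> y)"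
  have ran: "ran g = insert y (u ` ran f)"
  proof (intro equalityI subsetI)
    fix w assume "w \<in> ran g"
    then show "w \<in> insert y (u ` ran f)"
      by (auto simp: ran_def g_def split: if_splits)
  next
    fix w assume "w \<in> insert y (u ` ran f)"
    then consider "w = y" | v where "v \<in> ran f" "w = u v" by blast
    then show "w \<in> ran g"
    proof cases
      case 1
      then show ?thesis by (auto simp: ran_def g_def)
    next
      case 2
      then obtain x where "x \<noteq> x\<^sub>1" "f x = Some v"
        using x1(2) by (auto simp: ran_def) metis
      then have "g x = Some w" using 2 by (simp add: g_def)
      then show ?thesis by (rule ranI)
    qed
  qed
  have "inj_on u (ran f)"
    using u(2) by (auto simp: inj_on_def)
  then have card: "card (ran g) = Suc (card (ran f))"
    using ran y(2) fin_ran[OF f] by (simp add: card_image)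
  have "dom g \<subseteq> X"
    using f x1(1) by (auto simp: g_def partial_maps_def split: if_splits)
  moreover have "u ` ran f \<subseteq> Y"
    using u(1) dom_a by blast
  ultimately have S: "g \<in> S"
    using ran y(1) by (simp add: partial_maps_def)
  have ga: "Option.bind (g x) a = (if x = x\<^sub>1 then a y else Option.bind (f x) (a \<circ> u))" for x
    by (cases "f x") (auto simp: g_def)
  have "Option.bind (g x) a \<noteq> None" if "x \<in> dom f" for x
  proof -
    obtain v where v: "f x = Some v" using \<open>x \<in> dom f\<close> by auto
    then have "u v \<in> dom a" by (intro u(1) ranI)
    then show ?thesis using v y(3) by (cases "x = x\<^sub>1"; cases "a y") (auto simp: ga)
  qed
  moreover have "f x = f x'" if "Option.bind (g x) a = Option.bind (g x') a" "Option.bind (g x) a \<noteq> None" for x x'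
  proof -
    \<comment> \<open>\<open>*\<close> compares \<open>x\<^sub>1\<close> with a point that keeps its
      representative, \<open>**\<close> compares two such points.\<close>
    have *: "f z = f x\<^sub>1" if "Option.bind (f z) (a \<circ> u) = a y" "a y \<noteq> None" for z
    proof (cases "f z")
      case None
      then show ?thesis using that by simp
    next
      case (Some v)
      then have "v \<in> ran f" by (rule ranI)
      then show ?thesis using that y(4) Some by simp
    qed
    have **: "f z = f z'" if "Option.bind (f z) (a \<circ> u) = Option.bind (f z') (a \<circ> u)" "Option.bind (f z) (a \<circ> u) \<noteq> None" for z z'
      using that by (cases "f z"; cases "f z'") (auto intro: inj_onD[OF u(2)] ranI)
    show ?thesis
      using that *[of x] *[of x'] **[of x x'] by (auto simp: ga split: if_splits)
  qed
  ultimately show ?thesis using card S by blast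
qed

text \<open>The values other than \<open>v\<close> are injected into \<open>ran a\<close> minus the
  image of \<open>y\<close>, then lifted through \<open>a\<close>. Prescribing the representative of
  \<open>v\<close> controls which image an extra value may share.\<close>

lemma ex_transversal:
  assumes "finite R" "card (insert v R) \<le> \<alpha>" "y \<in> dom a"
  shows "\<exists>u. u v = y \<and> (\<forall>w\<in>insert v R. u w \<in> dom a) \<and> inj_on (\<lambda>w. a (u w)) (insert v R)"
proof -
  obtain z where z: "a y = Some z" using assms(3) by auto
  then have zr: "z \<in> ran a" by (rule ranI)
  have "card (R - {v}) \<le> card (ran a - {z})"
    using assms(1,2) zr ran_a(2) rank_a by (simp add: card.insert_remove)
  then obtain b where b: "b ` (R - {v}) \<subseteq> ran a - {z}" "inj_on b (R - {v})"
    using assms(1) ran_a(2) by (meson card_le_inj finite_Diff)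
  define t where "t z = (SOME y. a y = Some z)" for z
  have t: "a (t z) = Some z" if "z \<in> ran a" for z
    using that unfolding t_def by (auto simp: ran_def intro: someI_ex)
  define u where "u w = (if w = v then y else t (b w))" for w
  have au: "a (u w) = Some (if w = v then z else b w)" if "w \<in> insert v R" for w
    using that z t b(1) by (auto simp: u_def)
  have "inj_on (\<lambda>w. a (u w)) (insert v R)"
    using b by (auto simp: inj_on_def au)
  moreover have "u v = y" by (simp add: u_def)
  ultimately show ?thesis using au by blast
qed

text \<open>The work lies in finding \<open>x\<^sub>1\<close>, \<open>y\<close> and \<open>u\<close>
  for \<open>left_factor\<close>. The cases are rank below \<alpha>, and, at rank \<alpha>, the two
  ways of not being critical.\<close>

lemma product_of_higher_rank:
  assumes f: "f \<in> S" "card (ran f) \<le> \<alpha>" "f \<notin> critical"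
  shows "\<exists>g\<in>S. \<exists>h\<in>S. card (ran g) = Suc (card (ran f)) \<and> card (ran h) = Suc (card (ran f)) \<and> f = sandwich a g h"
proof -
  \<comment> \<open>A point whose value can be changed without losing any value of \<open>f\<close>.
    Otherwise \<open>f\<close> would be total and injective on \<open>X\<close>, of rank above
    \<alpha>.\<close>
  obtain x\<^sub>1 where defect: "x\<^sub>1 \<in> X" "\<And>v. f x\<^sub>1 = Some v \<Longrightarrow> \<exists>x. x \<noteq> x\<^sub>1 \<and> f x = Some v"
  proof (rule ccontr)
    assume "\<not> thesis"
    with that have *: "\<exists>v. f x = Some v \<and> (\<forall>x'. f x' = Some v \<longrightarrow> x' = x)" if "x \<in> X" for x
      using \<open>x \<in> X\<close> by metis
    then have "inj_on (\<lambda>x. the (f x)) X"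
      by (intro inj_onI) (metis option.sel)
    moreover have "(\<lambda>x. the (f x)) ` X \<subseteq> ran f"
    proof (rule image_subsetI)
      fix x assume "x \<in> X"
      then obtain v where "f x = Some v" using * by blast
      then show "the (f x) \<in> ran f" by (auto intro: ranI)
    qed
    ultimately have "card X \<le> card (ran f)"
      using fin_ran[OF f(1)] by (rule card_inj_on_le)
    then show False using f(2) \<alpha>_less_X by simp
  qed
  have "\<exists>x\<^sub>1 y u. (\<forall>v\<in>ran f. u v \<in> dom a) \<and> inj_on (\<lambda>v. a (u v)) (ran f) \<and> x\<^sub>1 \<in> X
    \<and> (\<forall>v. f x\<^sub>1 = Some v \<longrightarrow> (\<exists>x. x \<noteq> x\<^sub>1 \<and> f x = Some v)) \<and> y \<in> Y \<and> y \<notin> u ` ran f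
    \<and> (a y = None \<longrightarrow> f x\<^sub>1 = None) \<and> (\<forall>v\<in>ran f. a y = a (u v) \<longrightarrow> f x\<^sub>1 = Some v)"
  proof (cases "card (ran f) = \<alpha>")
    case False
    obtain y where y: "y \<in> dom a"
      using dom_a_nonempty by blast
    \<comment> \<open>A dummy value \<open>v\<close>: its representative \<open>y\<close> is the extra value of the left factor.\<close>
    obtain v where v: "v \<notin> ran f" using room_Y fin_ran f by blast
    then have "card (insert v (ran f)) \<le> \<alpha>" using False f fin_ran by auto
    then obtain u where u: "u v = y" "\<forall>w\<in>insert v (ran f). u w \<in> dom a" "inj_on (\<lambda>w. a (u w)) (insert v (ran f))"
      using ex_transversal[OF fin_ran[OF f(1)] _ y] by blast
    have "a y \<noteq> a (u w)" if "w \<in> ran f" for w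
      using u(1,3) v that by (auto simp: inj_on_def)
    moreover from this have "y \<notin> u ` ran f" by auto
    moreover have "inj_on (\<lambda>w. a (u w)) (ran f)"
      using u(3) by (rule inj_on_subset) blast
    moreover have "a y \<noteq> None" "y \<in> Y" using y dom_a by auto
    ultimately show ?thesis
      using u(2) defect by (intro exI[of _ x\<^sub>1] exI[of _ y] exI[of _ u]) blast
  next
    case True
    \<comment> \<open>The representatives now use up all of \<open>ran a\<close>, so the extra value
      must lie outside \<open>dom a\<close> or share its image with a representative.\<close>
    then consider x\<^sub>1 y where "x\<^sub>1 \<in> X" "f x\<^sub>1 = None" "y \<in> Y" "a y = None"
      | "\<not> inj_on f (dom f)" "\<not> inj_on a (dom a)"
      proof -
      have "(\<exists>x\<in>X. f x = None) \<and> (\<exists>y\<in>Y. a y = None) \<or> \<not> inj_on f (dom f) \<and> \<not> inj_on a (dom a)"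
      proof (rule ccontr)
        assume neg: "\<not> ?thesis"
        have "dom f = X \<or> dom a = Y"
        proof (rule ccontr)
          assume "\<not> ?thesis"
          then obtain x y where "x \<in> X - dom f" "y \<in> Y - dom a"
            using f(1) dom_a by (auto simp: partial_maps_def)
          then show False using neg by (auto simp: domIff)
        qed
        then show False using neg f True by (auto simp: critical_def)
      qed
      then show thesis using that by blast
    qed
    then show ?thesis
    proof cases
      case 1
      obtain v where "v \<in> ran f" using True \<alpha>_pos by fastforce
      \<comment> \<open>Inserting a value already present lets \<open>ex_transversal\<close> apply
        to \<open>ran f\<close> itself.\<close>
      then have ins: "insert v (ran f) = ran f" by blast
      obtain z where "z \<in> dom a"
        using dom_a_nonempty by blast
      then obtain u where u: "\<forall>w\<in>ran f. u w \<in> dom a" "inj_on (\<lambda>w. a (u w)) (ran f)"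
        using ex_transversal[OF fin_ran[OF f(1)], of v z] f(2) unfolding ins by blast
      have "y \<notin> u ` ran f" "\<And>w. w \<in> ran f \<Longrightarrow> a y \<noteq> a (u w)" using u(1) 1(4) by auto
      then show ?thesis
        using u 1 by (intro exI[of _ x\<^sub>1] exI[of _ y] exI[of _ u]) simp
    next
      case 2
      \<comment> \<open>\<open>y\<^sub>1\<close> will represent the repeated value \<open>v\<close>,
        and \<open>x\<^sub>1\<close> alone is moved to \<open>y\<^sub>2\<close>; \<open>a\<close>
        identifies the two again.\<close>
      obtain x\<^sub>1 x\<^sub>2 v where x: "x\<^sub>1 \<noteq> x\<^sub>2" "f x\<^sub>1 = Some v" "f x\<^sub>2 = Some v"
        using 2(1) by (auto simp: inj_on_def)
      obtain y\<^sub>1 y\<^sub>2 where y: "y\<^sub>1 \<noteq> y\<^sub>2" "a y\<^sub>1 = a y\<^sub>2" "y\<^sub>1 \<in> dom a" "y\<^sub>2 \<in> dom a"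
        using 2(2) by (auto simp: inj_on_def)
      have v: "v \<in> ran f" using x(2) by (rule ranI)
      then have ins: "insert v (ran f) = ran f" by blast
      obtain u where u: "u v = y\<^sub>1" "\<forall>w\<in>ran f. u w \<in> dom a" "inj_on (\<lambda>w. a (u w)) (ran f)"
        using ex_transversal[OF fin_ran[OF f(1)], of v y\<^sub>1] f(2) y(3) unfolding ins by blast
      have *: "w = v" if "w \<in> ran f" "a y\<^sub>2 = a (u w)" for w
        using u(1,3) y(2) v that by (auto simp: inj_on_def)
      then have "y\<^sub>2 \<notin> u ` ran f" using u(1) y(1) by auto
      moreover have "x\<^sub>1 \<in> X" "y\<^sub>2 \<in> Y" "a y\<^sub>2 \<noteq> None"
        using partial_mapsD[OF f(1) x(2)] y(4) dom_a by auto
      moreover have "\<exists>x. x \<noteq> x\<^sub>1 \<and> f x = Some w" if "f x\<^sub>1 = Some w" for w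
        using x that by (intro exI[of _ x\<^sub>2]) simp
      ultimately show ?thesis
        using u(2,3) * x(2) by (intro exI[of _ x\<^sub>1] exI[of _ y\<^sub>2] exI[of _ u]) blast
    qed
  qed
  then obtain x\<^sub>1 y u where "\<forall>v\<in>ran f. u v \<in> dom a" "inj_on (\<lambda>v. a (u v)) (ran f)" "x\<^sub>1 \<in> X"
    "\<forall>v. f x\<^sub>1 = Some v \<longrightarrow> (\<exists>x. x \<noteq> x\<^sub>1 \<and> f x = Some v)" "y \<in> Y" "y \<notin> u ` ran f"
    "a y = None \<longrightarrow> f x\<^sub>1 = None" "\<forall>v\<in>ran f. a y = a (u v) \<longrightarrow> f x\<^sub>1 = Some v"
    by (elim exE conjE)
  then have "\<exists>g\<in>S. card (ran g) = Suc (card (ran f)) \<and>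
    (\<forall>x\<in>dom f. Option.bind (g x) a \<noteq> None) \<and>
    (\<forall>x x'. Option.bind (g x) a = Option.bind (g x') a \<longrightarrow> Option.bind (g x) a \<noteq> None \<longrightarrow> f x = f x')"
    by (intro left_factor[OF f(1), of u x\<^sub>1 y]) simp_all
  then obtain g where g: "g \<in> S" "card (ran g) = Suc (card (ran f))"
    "\<And>x. x \<in> dom f \<Longrightarrow> Option.bind (g x) a \<noteq> None"
    "\<And>x x'. Option.bind (g x) a = Option.bind (g x') a \<Longrightarrow> Option.bind (g x) a \<noteq> None \<Longrightarrow> f x = f x'"
    by blast
  then show ?thesis
    using right_factor[OF f(1,2) g(1,3,4)] by blast
qed

section \<open>Critical maps and their kernels\<close>

text \<open>One generator per kernel suffices: if the values of \<open>g\<close> are representatives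
  with distinct images under \<open>a\<close>, then \<open>a\<close> loses nothing of
  \<open>g\<close>, so each \<open>f'\<close> with this kernel factors through it. The right factor
  has rank \<alpha> + 1 and thus lies in \<open>high_rank\<close>.\<close>

lemma critical_representative:
  assumes "f \<in> critical"
  shows "\<exists>g\<in>critical. pker g = pker f \<and> (\<forall>f'\<in>critical. pker f' = pker f \<longrightarrow> (\<exists>h\<in>high_rank. f' = sandwich a g h))"
proof -
  have f: "f \<in> S" "card (ran f) = \<alpha>" using assms by (auto simp: critical_def)
  obtain v where "v \<in> ran f" using f(2) \<alpha>_pos by fastforce
  then have ins: "insert v (ran f) = ran f" by blast
  obtain z where "z \<in> dom a"
    using dom_a_nonempty by blast
  then obtain u where u: "\<forall>w\<in>ran f. u w \<in> dom a" "inj_on (\<lambda>w. a (u w)) (ran f)"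
    using ex_transversal[OF fin_ran[OF f(1)], of v z] f(2) unfolding ins by blast
  define g where "g = map_option u \<circ> f"
  have inju: "inj_on u (ran f)" using u(2) by (auto simp: inj_on_def)
  have rang: "ran g = u ` ran f" by (auto simp: g_def ran_def image_iff)
  have domg: "dom g = dom f" by (auto simp: g_def dom_def)
  have gS: "g \<in> S" using f(1) domg rang u(1) dom_a by (auto simp: partial_maps_def)
  have kerg: "g x = g y \<longleftrightarrow> f x = f y" for x y
    using inj_onD[OF inju] by (cases "f x"; cases "f y") (auto simp: g_def ran_def)
  have pk: "pker g = pker f" by (rule pker_eqI) (simp_all add: domg kerg)
  have "inj_on g (dom g) \<longleftrightarrow> inj_on f (dom f)"
    by (simp add: inj_on_def domg kerg)
  then have gc: "g \<in> critical"
    using assms gS domg rang card_image[OF inju] by (simp add: critical_def)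
  have "\<exists>h\<in>high_rank. f' = sandwich a g h" if f': "f' \<in> critical" "pker f' = pker f" for f'
  proof -
    have f'S: "f' \<in> S" "card (ran f') = \<alpha>" using f'(1) by (auto simp: critical_def)
    have ga: "Option.bind (g x) a = Option.bind (f x) (a \<circ> u)" for x
      by (cases "f x") (auto simp: g_def)
    have "\<exists>h\<in>S. card (ran h) = Suc (card (ran f')) \<and> f' = sandwich a g h"
    proof (rule right_factor[OF f'S(1) _ gS])
      fix x assume "x \<in> dom f'"
      then show "Option.bind (g x) a \<noteq> None"
        using pker_eqD(1)[OF f'(2)] u(1) by (auto simp: ga ran_def)
    next
      fix x x' assume "Option.bind (g x) a = Option.bind (g x') a" "Option.bind (g x) a \<noteq> None"
      then have "f x = f x'" "x \<in> dom f"
        using inj_onD[OF u(2)] by (cases "f x"; cases "f x'"; auto simp: ga ran_def)+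
      then show "f' x = f' x'"
        using pker_eqD[OF f'(2)] by blast
    qed (simp add: f'S)
    then show ?thesis using f'S(2) by (auto simp: high_rank_def)
  qed
  then show ?thesis using gc pk by blast
qed

text \<open>Each value of the product is determined by a value of \<open>f\<close>, and also by a
  point of \<open>ran a\<close> at which \<open>g\<close> is defined.\<close>

lemma rank_sandwich_le:
  assumes "f \<in> S"
  shows "card (ran (sandwich a f g)) \<le> card (ran f)"
    and "card (ran (sandwich a f g)) \<le> card (ran a \<inter> dom g)"
proof -
  have "ran (sandwich a f g) \<subseteq> (\<lambda>y. the (Option.bind (a y) g)) ` ran f"
  proof
    fix w assume "w \<in> ran (sandwich a f g)"
    then obtain x where "sandwich a f g x = Some w" by (auto simp: ran_def)
    then obtain y where "f x = Some y" "Option.bind (a y) g = Some w"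
      by (cases "f x") (auto simp: sandwich_apply)
    then show "w \<in> (\<lambda>y. the (Option.bind (a y) g)) ` ran f"
      by (force simp: ran_def)
  qed
  then show "card (ran (sandwich a f g)) \<le> card (ran f)"
    by (rule surj_card_le[OF fin_ran[OF assms]])
  have "ran (sandwich a f g) \<subseteq> (\<lambda>z. the (g z)) ` (ran a \<inter> dom g)"
  proof
    fix w assume "w \<in> ran (sandwich a f g)"
    then obtain x where "sandwich a f g x = Some w" by (auto simp: ran_def)
    then obtain y z where "a y = Some z" "g z = Some w"
      by (auto simp: sandwich_apply bind_eq_Some_conv)
    then show "w \<in> (\<lambda>z. the (g z)) ` (ran a \<inter> dom g)"
      by (force simp: ran_def)
  qed
  then show "card (ran (sandwich a f g)) \<le> card (ran a \<inter> dom g)"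
    by (rule surj_card_le[rotated]) (simp add: ran_a)
qed

lemma rank_sandwich_le_\<alpha>: "f \<in> S \<Longrightarrow> card (ran (sandwich a f g)) \<le> \<alpha>"
  using rank_sandwich_le(2)[of f g] card_mono[OF ran_a(2), of "ran a \<inter> dom g"] rank_a by simp

text \<open>The left factor has the same domain and rank as the product, so the passage from its
  values to those of the product is injective and the kernels agree.\<close>

lemma critical_left_factor:
  assumes f: "f \<in> S" and p: "sandwich a f g \<in> critical"
  shows "f \<in> critical \<and> pker f = pker (sandwich a f g)"
proof -
  let ?p = "sandwich a f g"
  have pS: "?p \<in> S" "card (ran ?p) = \<alpha>" using p by (auto simp: critical_def)
  \<comment> \<open>Rank \<alpha> leaves no room for \<open>g\<close> to be undefined on
    \<open>ran a\<close>.\<close>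
  have "ran a \<inter> dom g = ran a"
    using rank_sandwich_le(2)[OF f, of g] ran_a(2) rank_a pS(2)
    by (intro card_seteq) auto
  then have sub: "ran a \<subseteq> dom g" by blast
  have p_at: "?p x = Option.bind (a y) g" if "f x = Some y" for x y
    using that by (simp add: sandwich_apply)
  have domp: "dom ?p \<subseteq> dom f" by (auto simp: sandwich_apply bind_eq_Some_conv)
  \<comment> \<open>If \<open>a\<close> is full, no point of \<open>dom f\<close> is lost; otherwise
    criticality makes the product total on \<open>X\<close>.\<close>
  have full: "dom ?p = dom f"
  proof (cases "dom a = Y")
    case True
    have "x \<in> dom ?p" if "x \<in> dom f" for x
    proof -
      obtain y where y: "f x = Some y" using \<open>x \<in> dom f\<close> by auto
      then obtain z where z: "a y = Some z" using True partial_mapsD[OF f y] by blast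
      then have "z \<in> dom g" using sub by (auto simp: ran_def)
      then show ?thesis using y z by (auto simp: sandwich_apply)
    qed
    then show ?thesis using domp by blast
  next
    case False
    then show ?thesis using p domp f by (auto simp: critical_def partial_maps_def)
  qed
  have f_p: "?p x = ?p x'" if "f x = f x'" for x x'
    using that by (simp add: sandwich_apply)
  have inj: "inj_on f (dom f)" if "inj_on ?p (dom ?p)"
    by (intro inj_onI) (metis f_p full inj_onD that)
  \<comment> \<open>For injective \<open>a\<close>, the values of \<open>f\<close> lie in
    \<open>dom a\<close>, which has \<alpha> elements; otherwise the product is injective, so
    \<open>dom f\<close> itself has \<alpha> elements.\<close>
  have le: "card (ran f) \<le> \<alpha>"
  proof (cases "inj_on a (dom a)")
    case True
    have "ran f \<subseteq> dom a"
    proof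
      fix y assume "y \<in> ran f"
      then obtain x where x: "f x = Some y" by (auto simp: ran_def)
      then have "x \<in> dom ?p" using full by auto
      then obtain w where "Option.bind (a y) g = Some w" using p_at[OF x] by (metis domD)
      then show "y \<in> dom a" by (auto simp: bind_eq_Some_conv)
    qed
    then show ?thesis using finite_dom_a_inj[OF True] by (metis card_mono)
  next
    case False
    then have "inj_on ?p (dom ?p)" using p by (simp add: critical_def)
    then show ?thesis
      using card_ran_inj card_ran_le_card_dom[OF finite_dom[OF f]] pS(2) full by metis
  qed
  then have rf: "card (ran f) = \<alpha>"
    using rank_sandwich_le(1)[OF f, of g] pS(2) by simp
  have "f \<in> critical"
    using f rf inj p full by (auto simp: critical_def)
  moreover have "pker f = pker ?p"
  proof (rule pker_eqI)
    define q where "q y = the (Option.bind (a y) g)" for y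
    have pq: "?p x = map_option q (f x)" if "x \<in> dom f" for x
    proof -
      obtain y where y: "f x = Some y" using \<open>x \<in> dom f\<close> by auto
      moreover have "Option.bind (a y) g \<noteq> None"
        using \<open>x \<in> dom f\<close> p_at[OF y] full by (metis domIff)
      ultimately show ?thesis using p_at[OF y] by (simp add: q_def)
    qed
    have "Some ` ran ?p = ?p ` dom f"
      by (simp only: image_dom_eq_Some_ran flip: full)
    also have "\<dots> = map_option q ` f ` dom f"
      using pq by (simp add: image_image cong: image_cong)
    also have "\<dots> = Some ` q ` ran f"
      by (simp add: image_dom_eq_Some_ran image_image)
    finally have "Some ` ran ?p = Some ` q ` ran f" .
    then have "ran ?p = q ` ran f" by (simp add: inj_image_eq_iff)
    \<comment> \<open>\<open>q\<close> maps \<open>ran f\<close> onto a set of the same finite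
      cardinality.\<close>
    then have inj_q: "inj_on q (ran f)"
      using fin_ran[OF f] rf pS(2) by (metis eq_card_imp_inj_on)
    show "f x = f y \<longleftrightarrow> ?p x = ?p y" if xy: "x \<in> dom f" "y \<in> dom f" for x y
    proof -
      obtain v w where "f x = Some v" "f y = Some w" using xy by blast
      moreover from this have "v \<in> ran f" "w \<in> ran f" by (auto intro: ranI)
      ultimately show ?thesis
        using pq[OF xy(1)] pq[OF xy(2)] inj_on_eq_iff[OF inj_q, of v w] by simp
    qed
  qed (simp add: full)
  ultimately show ?thesis by blast
qed

section \<open>Generating sets and their least size\<close>

lemma generating_contains_high_rank:
  assumes "B \<subseteq> S" "subsemigroup_gen (sandwich a) B = S"
  shows "high_rank \<subseteq> B"
proof
  fix f assume f: "f \<in> high_rank"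
  then have "f \<in> subsemigroup_gen (sandwich a) B" using assms(2) by (simp add: high_rank_def)
  then show "f \<in> B"
  proof cases
    case (mult x y)
    then have "card (ran f) \<le> \<alpha>" using assms(2) rank_sandwich_le_\<alpha> by simp
    then show ?thesis using f by (simp add: high_rank_def)
  qed
qed

text \<open>Passing to the left factor repeatedly keeps criticality and kernel until a generator is
  reached.\<close>

lemma generating_meets_critical:
  assumes "B \<subseteq> S" "subsemigroup_gen (sandwich a) B = S" "f \<in> critical"
  shows "\<exists>g\<in>B \<inter> critical. pker g = pker f"
proof -
  have "f \<in> subsemigroup_gen (sandwich a) B" using assms by (simp add: critical_def)
  then show ?thesis using assms(3)
  proof (induction rule: subsemigroup_gen.induct)
    case (mult x y)
    then have "x \<in> critical \<and> pker x = pker (sandwich a x y)"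
      using assms(2) by (intro critical_left_factor) auto
    with mult.IH(1) show ?case by auto
  qed auto
qed

text \<open>Descending induction on the rank: maps of rank above \<alpha> and critical maps are
  given, and any other map is a product of two maps of rank one higher.\<close>

lemma generated:
  assumes "high_rank \<subseteq> A" "A \<subseteq> S"
    and "critical \<subseteq> subsemigroup_gen (sandwich a) A"
  shows "subsemigroup_gen (sandwich a) A = S"
proof
  have "f \<in> S" if "f \<in> subsemigroup_gen (sandwich a) A" for f
    using that assms(2) by induction (auto intro: sandwich_closed)
  then show "subsemigroup_gen (sandwich a) A \<subseteq> S" by blast
  have "f \<in> subsemigroup_gen (sandwich a) A" if "f \<in> S" for f
    using that
  \<comment> \<open>The measure is positive for every rank up to \<alpha>, so raising such a rank by
    one strictly decreases it.\<close>
  proof (induction "Suc \<alpha> - card (ran f)" arbitrary: f rule: less_induct)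
    case less
    consider "f \<in> high_rank" | "f \<in> critical" | "card (ran f) \<le> \<alpha>" "f \<notin> critical"
      using less.prems by (cases "f \<in> critical"; cases "\<alpha> < card (ran f)") (auto simp: high_rank_def)
    then show ?case
    proof cases
      case 3
      then obtain g h where "g \<in> S" "h \<in> S" "f = sandwich a g h"
        "card (ran g) = Suc (card (ran f))" "card (ran h) = Suc (card (ran f))"
        using product_of_higher_rank[OF less.prems] by blast
      then show ?thesis
        using less.hyps[of g] less.hyps[of h] 3(1) by (auto intro: subsemigroup_gen.mult)
    qed (use assms in \<open>auto intro: subsemigroup_gen.base\<close>)
  qed
  then show "S \<subseteq> subsemigroup_gen (sandwich a) A" by blast
qed

text \<open>The bound is attained by \<open>high_rank\<close> with one representative per critical
  kernel. Any generating set contains \<open>high_rank\<close> and, disjointly from it, critical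
  maps realising every critical kernel.\<close>

lemma semigroup_rank_eq: "semigroup_rank S (sandwich a) = ecard high_rank + ecard (pker ` critical)"
proof -
  obtain rep where rep: "\<And>f. f \<in> critical \<Longrightarrow> rep f \<in> critical \<and> pker (rep f) = pker f \<and>
      (\<forall>f'\<in>critical. pker f' = pker f \<longrightarrow> (\<exists>h\<in>high_rank. f' = sandwich a (rep f) h))"
    using critical_representative by metis
  \<comment> \<open>Choosing by kernel rather than by map gives all critical maps with a common
    kernel the same generator.\<close>
  define r where "r K = rep (SOME f. f \<in> critical \<and> pker f = K)" for K
  have r: "r (pker f) \<in> critical \<and> pker (r (pker f)) = pker f \<and> (\<exists>h\<in>high_rank. f = sandwich a (r (pker f)) h)"
    if "f \<in> critical" for f
  proof -
    define f\<^sub>0 where "f\<^sub>0 = (SOME f'. f' \<in> critical \<and> pker f' = pker f)"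
    have "f\<^sub>0 \<in> critical \<and> pker f\<^sub>0 = pker f"
      unfolding f\<^sub>0_def by (rule someI[of _ f]) (simp add: that)
    then show ?thesis
      using rep[of f\<^sub>0] that by (simp add: r_def flip: f\<^sub>0_def)
  qed
  let ?G = "r ` pker ` critical"
  have disj: "high_rank \<inter> critical = {}" by (auto simp: high_rank_def critical_def)
  have G: "?G \<subseteq> critical" using r by blast
  have inj: "inj_on r (pker ` critical)"
    by (rule inj_on_inverseI[of _ pker]) (use r in auto)
  have "semigroup_rank S (sandwich a) = ecard (high_rank \<union> ?G)"
  proof (rule semigroup_rank_eqI)
    show "high_rank \<union> ?G \<subseteq> S" using G by (auto simp: high_rank_def critical_def)
    then show "subsemigroup_gen (sandwich a) (high_rank \<union> ?G) = S"
    proof (rule generated[rotated])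
      show "critical \<subseteq> subsemigroup_gen (sandwich a) (high_rank \<union> ?G)"
      proof
        fix f assume f: "f \<in> critical"
        then obtain h where "h \<in> high_rank" "f = sandwich a (r (pker f)) h" using r by blast
        with f show "f \<in> subsemigroup_gen (sandwich a) (high_rank \<union> ?G)"
          by (metis UnCI imageI subsemigroup_gen.base subsemigroup_gen.mult)
      qed
    qed simp
  next
    fix B assume B: "B \<subseteq> S" "subsemigroup_gen (sandwich a) B = S"
    have "pker ` critical \<subseteq> pker ` (B \<inter> critical)"
      using generating_meets_critical[OF B] by (metis image_eqI image_subsetI)
    then have "ecard (pker ` critical) \<le> ecard (B \<inter> critical)"
      by (rule order_trans[OF ecard_mono ecard_image_le])
    moreover have "ecard (high_rank \<union> ?G) = ecard high_rank + ecard (pker ` critical)"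
      using disj G ecard_image[OF inj] by (subst ecard_Un_disjoint) auto
    moreover have "ecard high_rank + ecard (B \<inter> critical) = ecard (high_rank \<union> (B \<inter> critical))"
      using disj by (subst ecard_Un_disjoint) auto
    moreover have "\<dots> \<le> ecard B"
      using generating_contains_high_rank[OF B] by (intro ecard_mono) auto
    ultimately show "ecard (high_rank \<union> ?G) \<le> ecard B"
      by (metis add_left_mono order_trans)
  qed
  also have "\<dots> = ecard high_rank + ecard (pker ` critical)"
    using disj G ecard_image[OF inj] by (subst ecard_Un_disjoint) auto
  finally show ?thesis .
qed

section \<open>Evaluation of the two summands\<close>

text \<open>In each case on \<open>a\<close>, the disjunctions defining \<open>critical\<close>
  reduce to conditions on \<open>f\<close> alone.\<close>

lemma ecard_critical:
  "ecard (pker ` critical) = (if \<not> inj_on a (dom a) \<and> dom a \<noteq> Y then 0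
       else if inj_on a (dom a) then enat (num_equivs (card X) \<alpha>)
       else num_subsets X \<alpha>)"
proof -
  have Y: "finite Y \<Longrightarrow> \<alpha> \<le> card Y" using \<alpha>_less_Y by auto
  consider "\<not> inj_on a (dom a)" "dom a \<noteq> Y" | "inj_on a (dom a)" | "\<not> inj_on a (dom a)" "dom a = Y"
    by blast
  then show ?thesis
  proof cases
    case 1
    \<comment> \<open>Such an \<open>f\<close> would be total and injective, so of rank
      \<open>card X\<close>.\<close>
    have False if "f \<in> critical" for f
    proof -
      have "inj_on f (dom f)" "dom f = X" "card (ran f) = \<alpha>"
        using that 1 by (auto simp: critical_def)
      then have "card X = \<alpha>"
        using card_ran_inj by metis
      then show False using \<alpha>_less_X by simp
    qed
    then have "critical = {}" by blast
    then show ?thesis using 1 by (simp add: ecard_def zero_enat_def)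
  next
    case 2
    \<comment> \<open>An injective full \<open>a\<close> would give \<open>Y\<close> exactly
      \<alpha> elements.\<close>
    have "dom a \<noteq> Y"
    proof
      assume "dom a = Y"
      then show False using finite_dom_a_inj[OF 2] \<alpha>_less_Y by simp
    qed
    then have "critical = {f \<in> S. card (ran f) = \<alpha> \<and> dom f = X}"
      using 2 by (auto simp: critical_def)
    then show ?thesis using 2 ecard_pker_total[OF finite_X Y] by simp
  next
    case 3
    then have "critical = {f \<in> S. card (ran f) = \<alpha> \<and> inj_on f (dom f)}"
      by (auto simp: critical_def)
    then show ?thesis using 3 ecard_pker_inj[OF finite_X Y] by simp
  qed
qed

lemma ecard_high_rank:
  assumes "\<And>f. f \<in> S \<Longrightarrow> card (ran f) \<le> \<xi>"
  shows "ecard high_rank = (\<Sum>\<mu>=\<alpha>+1..\<xi>. enat (fact \<mu>) * num_subsets Y \<mu> * enat (num_equivs (card X + 1) (\<mu> + 1)))"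
proof -
  have "high_rank = (\<Union>\<mu>\<in>{\<alpha>+1..\<xi>}. {f \<in> S. card (ran f) = \<mu>})"
    using assms by (auto simp: high_rank_def)
  then have "ecard high_rank = (\<Sum>\<mu>=\<alpha>+1..\<xi>. ecard {f \<in> S. card (ran f) = \<mu>})"
    by (simp only:) (rule ecard_UN_disjoint, auto)
  then show ?thesis
    by (simp only: ecard_rank_eq[OF finite_X])
qed

end

theorem theorem2p57:
  fixes X :: "'a set" and Y :: "'b set" and a :: "'b \<rightharpoonup> 'a" and \<xi> \<alpha> :: nat
  assumes "finite X"
    and "countable Y"
    and "enat \<xi> = min (ecard X) (ecard Y)"
    and "a \<in> partial_maps Y X"
    and "enat \<alpha> = ecard (ran a)"
    and "1 \<le> \<alpha>"
    and "\<alpha> < \<xi>"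
  shows "semigroup_rank (partial_maps X Y) (sandwich a) =
    (\<Sum>\<mu>=\<alpha>+1..\<xi>. enat (fact \<mu>) * num_subsets Y \<mu> * enat (num_equivs (card X + 1) (\<mu> + 1)))
    + (if \<not> inj_on a (dom a) \<and> dom a \<noteq> Y then 0
       else if inj_on a (dom a) then enat (num_equivs (card X) \<alpha>)
       else num_subsets X \<alpha>)"
proof -
  \<comment> \<open>The split on \<open>Y\<close> reflects that \<open>ecard\<close> is infinite for
    infinite \<open>Y\<close>, in which case the minimum is \<open>card X\<close>.\<close>
  have \<xi>: "\<xi> \<le> card X" "finite Y \<Longrightarrow> \<xi> \<le> card Y"
    and \<xi>': "\<xi> = (if finite Y then min (card X) (card Y) else card X)"
    using assms(1,3) by (auto simp: ecard_def min_def split: if_splits)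
  interpret low_rank_sandwich X Y a \<alpha>
  proof
    show "\<alpha> < card X" using assms(7) \<xi>(1) by simp
    show "\<alpha> < card Y" if "finite Y" using assms(7) \<xi>(2)[OF that] by simp
    show "card (ran a) = \<alpha>" using assms(5) by (simp add: ecard_def split: if_splits)
  qed (fact assms)+
  have "card (ran f) \<le> \<xi>" if f: "f \<in> S" for f
  proof -
    have "card (ran f) \<le> card (dom f)"
      by (rule card_ran_le_card_dom[OF finite_dom[OF f]])
    also have "\<dots> \<le> card X"
      using f finite_X by (intro card_mono) (auto simp: partial_maps_def)
    finally have "card (ran f) \<le> card X" .
    moreover have "card (ran f) \<le> card Y" if "finite Y"
      using f that by (intro card_mono) (auto simp: partial_maps_def)
    ultimately show ?thesis by (simp add: \<xi>')
  qed
  then show ?thesis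
    using semigroup_rank_eq ecard_high_rank ecard_critical by simp
qed

end
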